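(* Let $G$ be a graph on $n$ vertices and let $H(G)$ be its hairing. Then $H(G)$ is absolutely palindromic. Moreover, $H(G)$ is palindromic if and only if $H(G)$ is bipartite and $n$ is even, and $H(G)$ is antipalindromic if and only if $H(G)$ is bipartite and $n$ is odd.
   Context: All graphs are finite, simple and undirected. For a graph $G$ on $m$ vertices with adjacency matrix $A_G$, its characteristic polynomial is $\chi_G(\lambda)=\det(\lambda I-A_G)=a_0\lambda^m+a_1\lambda^{m-1}+\dots+a_m$ (so $a_0=1$). $G$ is palindromic if $a_i=a_{m-i}$ for all $i=0,\dots,m$; antipalindromic if $a_i=-a_{m-i}$ for all $i$; absolutely palindromic if $|a_i|=|a_{m-i}|$ for all $i$. The hairing $H(G)$ of $G=(V,E)$ is the graph with vertex set $V\times\{0,1\}$, with $(u,0)\sim(v,0)$ iff $uv\in E$, and $(u,0)\sim(u,1)$ for every $u\in V$, and no other edges (i.e. a pendant vertex is attached to every vertex of $G$); it has $2n$ vertices. *)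

theory Defs
  imports "Graph_Theory.Pair_Digraph" "Jordan_Normal_Form.Char_Poly"
begin

text \<open>Finite simple undirected graphs are rendered by the locale \<^locale>\<open>pair_graph\<close>: an edge
  \<open>uv\<close> is the pair of arcs \<open>(u, v)\<close> and \<open>(v, u)\<close>.\<close>

definition adjacency_matrix :: "'a pair_pre_digraph \<Rightarrow> 'a list \<Rightarrow> int mat" where
  "adjacency_matrix G vs =
     mat (length vs) (length vs) (\<lambda>(i, j). if (vs ! i, vs ! j) \<in> parcs G then 1 else 0)"

text \<open>The vertices are listed in an arbitrary order; by \<open>graph_char_poly_eq\<close> below the result
  does not depend on it.\<close>

definition graph_char_poly :: "'a pair_pre_digraph \<Rightarrow> int poly" where
  "graph_char_poly G =
     char_poly (adjacency_matrix G (SOME vs. distinct vs \<and> set vs = pverts G))"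

text \<open>Coefficients are indexed from the top: \<open>graph_coeff G i\<close> is the \<open>a\<^sub>i\<close> in
  \<open>a\<^sub>0 \<lambda>\<^sup>m + a\<^sub>1 \<lambda>\<^bsup>m-1\<^esup> + \<dots> + a\<^sub>m\<close>, where \<open>m\<close> is the number of vertices
  (meaningful for \<open>i \<le> m\<close> only).\<close>

definition graph_coeff :: "'a pair_pre_digraph \<Rightarrow> nat \<Rightarrow> int" where
  "graph_coeff G i = coeff (graph_char_poly G) (card (pverts G) - i)"

definition palindromic :: "'a pair_pre_digraph \<Rightarrow> bool" where
  "palindromic G \<longleftrightarrow>
     (\<forall>i \<le> card (pverts G). graph_coeff G i = graph_coeff G (card (pverts G) - i))"

definition antipalindromic :: "'a pair_pre_digraph \<Rightarrow> bool" where
  "antipalindromic G \<longleftrightarrow>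
     (\<forall>i \<le> card (pverts G). graph_coeff G i = - graph_coeff G (card (pverts G) - i))"

definition absolutely_palindromic :: "'a pair_pre_digraph \<Rightarrow> bool" where
  "absolutely_palindromic G \<longleftrightarrow>
     (\<forall>i \<le> card (pverts G). \<bar>graph_coeff G i\<bar> = \<bar>graph_coeff G (card (pverts G) - i)\<bar>)"

definition bipartite :: "'a pair_pre_digraph \<Rightarrow> bool" where
  "bipartite G \<longleftrightarrow>
     (\<exists>X Y. X \<union> Y = pverts G \<and> X \<inter> Y = {} \<and>
        (\<forall>(u, v) \<in> parcs G. (u \<in> X \<and> v \<in> Y) \<or> (u \<in> Y \<and> v \<in> X)))"

definition hairing :: "'a pair_pre_digraph \<Rightarrow> ('a \<times> nat) pair_pre_digraph" where
  "hairing G =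
     \<lparr> pverts = pverts G \<times> {0, 1},
       parcs = {((u, 0), (v, 0)) | u v. (u, v) \<in> parcs G}
             \<union> {((u, 0), (u, 1)) | u. u \<in> pverts G}
             \<union> {((u, 1), (u, 0)) | u. u \<in> pverts G} \<rparr>"

lemma card_pverts_hairing: "card (pverts (hairing G)) = 2 * card (pverts G)"
  by (simp add: hairing_def card_cartesian_product)

lemma pair_graph_hairing:
  assumes "pair_graph G"
  shows "pair_graph (hairing G)"
proof -
  interpret pair_graph G by fact
  have fin: "finite (pverts (hairing G))"
    using pair_finite_verts by (simp add: hairing_def)
  have sub: "parcs (hairing G) \<subseteq> pverts (hairing G) \<times> pverts (hairing G)"
    using in_arcsD1 in_arcsD2 by (auto simp: hairing_def)
  have sym: "(v, u) \<in> parcs G" if "(u, v) \<in> parcs G" for u v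
    using pair_sym_arcs that by (auto simp: symmetric_def dest: symD)
  show ?thesis
  proof
    show "finite (parcs (hairing G))"
      using finite_subset[OF sub] fin by blast
    show "symmetric (with_proj (hairing G))"
      using sym by (auto simp: symmetric_def hairing_def intro!: symI)
  next
    fix e assume "e \<in> parcs (hairing G)"
    then show "fst e \<noteq> snd e"
      using pair_no_loops by (fastforce simp: hairing_def)
  qed (use fin sub in auto)
qed

lemma char_poly_adjacency_matrix_cong:
  assumes vs: "distinct vs" and ws: "distinct ws" and eq: "set vs = set ws"
  shows "char_poly (adjacency_matrix G vs) = char_poly (adjacency_matrix G ws)"
proof -
  define n where "n = length vs"
  have nw: "length ws = n"
    using vs ws eq distinct_card unfolding n_def by metis
  define perm :: "'a list \<Rightarrow> 'a list \<Rightarrow> int mat"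
    where "perm xs ys = mat n n (\<lambda>(i, j). if xs ! i = ys ! j then 1 else 0)" for xs ys
  have pick: "(\<Sum>j = 0..<n. (if x = ys ! j then 1 else 0) * f (ys ! j)) = f x"
    if ys: "distinct ys" "length ys = n" "x \<in> set ys" for x :: 'a and ys and f :: "'a \<Rightarrow> int"
  proof -
    obtain k where k: "k < n" "x = ys ! k"
      using ys by (auto simp: in_set_conv_nth)
    have "(\<Sum>j = 0..<n. (if x = ys ! j then 1 else 0) * f (ys ! j))
        = (\<Sum>j = 0..<n. if j = k then f x else 0)"
      by (rule sum.cong) (use ys k in \<open>auto simp: nth_eq_iff_index_eq\<close>)
    also have "\<dots> = f x" using k by simp
    finally show ?thesis .
  qed
  have one: "perm xs ys * perm ys xs = 1\<^sub>m n"
    if "distinct xs" "distinct ys" "length xs = n" "length ys = n" "set xs = set ys" for xs ys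
  proof (rule eq_matI)
    fix i k assume "i < dim_row (1\<^sub>m n :: int mat)" "k < dim_col (1\<^sub>m n :: int mat)"
    then have ik: "i < n" "k < n" by auto
    have "xs ! i \<in> set ys" using that ik by (metis nth_mem)
    then show "(perm xs ys * perm ys xs) $$ (i, k) = 1\<^sub>m n $$ (i, k)"
      using pick[of ys "xs ! i" "\<lambda>y. if y = xs ! k then 1 else 0"] that ik
      by (simp add: perm_def scalar_prod_def nth_eq_iff_index_eq)
  qed (auto simp: perm_def)
  let ?A = "adjacency_matrix G vs" and ?B = "adjacency_matrix G ws"
  let ?P = "perm vs ws" and ?Q = "perm ws vs"
  have carr: "?A \<in> carrier_mat n n" "?B \<in> carrier_mat n n" "?P \<in> carrier_mat n n"
    "?Q \<in> carrier_mat n n"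
    by (auto simp: adjacency_matrix_def perm_def n_def nw[unfolded n_def])
  have PB: "?P * ?B = mat n n (\<lambda>(i, k). if (vs ! i, ws ! k) \<in> parcs G then 1 else 0)"
  proof (rule eq_matI)
    fix i k
    assume "i < dim_row (mat n n (\<lambda>(i, k). if (vs ! i, ws ! k) \<in> parcs G then 1 else 0 :: int))"
      "k < dim_col (mat n n (\<lambda>(i, k). if (vs ! i, ws ! k) \<in> parcs G then 1 else 0 :: int))"
    then have ik: "i < n" "k < n" by auto
    have "vs ! i \<in> set ws" using ik eq n_def by (metis nth_mem)
    then show "(?P * ?B) $$ (i, k)
        = mat n n (\<lambda>(i, k). if (vs ! i, ws ! k) \<in> parcs G then 1 else 0) $$ (i, k)"
      using pick[of ws "vs ! i" "\<lambda>y. if (y, ws ! k) \<in> parcs G then 1 else 0"] ik ws nw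
      by (simp add: perm_def adjacency_matrix_def scalar_prod_def)
  qed (auto simp: perm_def adjacency_matrix_def nw)
  have "?P * ?B * ?Q = ?A"
  proof (rule eq_matI)
    fix i k assume "i < dim_row ?A" "k < dim_col ?A"
    then have ik: "i < n" "k < n" by (auto simp: adjacency_matrix_def n_def)
    have "vs ! k \<in> set ws" using ik eq n_def by (metis nth_mem)
    then show "(?P * ?B * ?Q) $$ (i, k) = ?A $$ (i, k)"
      using pick[of ws "vs ! k" "\<lambda>y. if (vs ! i, y) \<in> parcs G then 1 else 0"] ik ws nw
      unfolding PB
      by (simp add: perm_def adjacency_matrix_def scalar_prod_def n_def mult.commute
          eq_commute[of "vs ! k"])
  qed (auto simp: perm_def adjacency_matrix_def n_def)
  then have "similar_mat ?A ?B"
    unfolding similar_mat_def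
    using similar_mat_witI[of ?P ?Q n ?A ?B] one vs ws eq nw carr n_def by metis
  then show ?thesis by (rule char_poly_similar)
qed

lemma graph_char_poly_eq:
  assumes "distinct vs" and "set vs = pverts G"
  shows "graph_char_poly G = char_poly (adjacency_matrix G vs)"
proof -
  define ws where "ws = (SOME ws. distinct ws \<and> set ws = pverts G)"
  have "distinct ws \<and> set ws = pverts G"
    unfolding ws_def by (rule someI[of _ vs]) (use assms in simp)
  then show ?thesis
    using char_poly_adjacency_matrix_cong[of ws vs G] assms
    by (simp add: graph_char_poly_def flip: ws_def)
qed

end

theory Submission
  imports Defs "Jordan_Normal_Form.Schur_Decomposition"
begin

text \<open>With respect to the block ordering, the adjacency matrix of \<open>H(G)\<close> is
  \<open>[[A, I], [I, 0]]\<close>, so \<open>\<chi>(x) = det ((x\<^sup>2 - 1) I - x A)\<close>. This expression is, up to the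
  factor \<open>(- 1)\<^sup>n x\<^bsup>2 n\<^esup>\<close>, invariant under \<open>x \<mapsto> - 1 / x\<close>; hence the coefficients \<open>c\<^sub>k\<close> of
  \<open>x\<^sup>k\<close> satisfy \<open>c\<^bsub>2n-k\<^esub> = (- 1)\<^bsup>n+k\<^esup> c\<^sub>k\<close>. Since \<open>c\<^bsub>2n\<^esub> = 1\<close>, being (anti)palindromic
  forces the parity of \<open>n\<close>, and then means that \<open>\<chi>\<close> is even, that is, that the adjacency matrix
  and its negative have the same characteristic polynomial. This characterises bipartiteness: a
  bipartition conjugates the adjacency matrix into its negative by a diagonal matrix of signs;
  conversely, a symmetric spectrum makes the traces of all odd powers vanish, so that there are
  no odd closed walks.\<close>

section \<open>Traces of matrix powers\<close>

definition mat_trace :: "'a :: comm_monoid_add mat \<Rightarrow> 'a" where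
  "mat_trace A = (\<Sum>i<dim_row A. A $$ (i, i))"

lemma mat_trace_mult_commute:
  fixes A B :: "'a :: comm_semiring_0 mat"
  assumes "A \<in> carrier_mat m n" "B \<in> carrier_mat n m"
  shows "mat_trace (A * B) = mat_trace (B * A)"
proof -
  have "mat_trace (A * B) = (\<Sum>i<m. \<Sum>j<n. A $$ (i, j) * B $$ (j, i))"
    using assms by (simp add: mat_trace_def scalar_prod_def atLeast0LessThan)
  also have "\<dots> = (\<Sum>j<n. \<Sum>i<m. B $$ (j, i) * A $$ (i, j))"
    by (subst sum.swap) (simp add: mult.commute)
  also have "\<dots> = mat_trace (B * A)"
    using assms by (simp add: mat_trace_def scalar_prod_def atLeast0LessThan)
  finally show ?thesis .
qed

lemma mat_trace_similar:
  fixes A B :: "'a :: comm_semiring_1 mat"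
  assumes "similar_mat_wit A B P Q"
  shows "mat_trace A = mat_trace B"
proof -
  define n where "n = dim_row A"
  have carr: "A \<in> carrier_mat n n" "B \<in> carrier_mat n n" "P \<in> carrier_mat n n" "Q \<in> carrier_mat n n"
    and QP: "Q * P = 1\<^sub>m n" and A: "A = P * B * Q"
    using similar_mat_witD[OF n_def assms] by auto
  have "mat_trace A = mat_trace (P * (B * Q))"
    unfolding A using carr by (simp add: assoc_mult_mat[of _ n n _ n _ n])
  also have "\<dots> = mat_trace (B * Q * P)"
    using carr by (intro mat_trace_mult_commute) auto
  also have "B * Q * P = B"
    using carr QP by (simp add: assoc_mult_mat[of _ n n _ n _ n])
  finally show ?thesis .
qed

text \<open>In a product of two upper triangular matrices the summand with middle index
  \<open>l\<close> in entry \<open>(i, j)\<close> can be nonzero only for \<open>i\<close> \<le>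
  \<open>l\<close> \<le> \<open>j\<close>. This range is empty below the diagonal and a single index
  on it.\<close>

lemma upper_triangular_pow:
  fixes A :: "'a :: semiring_1 mat"
  assumes A: "A \<in> carrier_mat n n" and ut: "upper_triangular A"
  shows "upper_triangular (A ^\<^sub>m k) \<and> (\<forall>i<n. (A ^\<^sub>m k) $$ (i, i) = A $$ (i, i) ^ k)"
proof (induction k)
  case 0
  then show ?case using A by auto
next
  case (Suc k)
  let ?B = "A ^\<^sub>m k"
  have B: "?B \<in> carrier_mat n n" using A by simp
  have zA: "A $$ (i, j) = 0" if "j < i" "i < n" for i j
    using ut A that by auto
  have zB: "?B $$ (i, j) = 0" if "j < i" "i < n" for i j
    using Suc.IH A that by auto
  have entry: "(?B * A) $$ (i, j) = (\<Sum>l<n. ?B $$ (i, l) * A $$ (l, j))" if "i < n" "j < n" for i j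
    using A B that by (simp add: scalar_prod_def atLeast0LessThan)
  have "(?B * A) $$ (i, j) = 0" if "j < i" "i < n" for i j
  proof -
    have "?B $$ (i, l) * A $$ (l, j) = 0" if "l < n" for l
      using \<open>j < i\<close> \<open>i < n\<close> that zA[of j l] zB[of l i] by (cases "l < i") auto
    then show ?thesis using entry that by (simp add: sum.neutral)
  qed
  moreover have "(?B * A) $$ (i, i) = A $$ (i, i) ^ Suc k" if "i < n" for i
  proof -
    have "(?B * A) $$ (i, i) = (\<Sum>l<n. if l = i then ?B $$ (i, i) * A $$ (i, i) else 0)"
      unfolding entry[OF that that]
    proof (rule sum.cong)
      fix l assume "l \<in> {..<n}"
      then show "?B $$ (i, l) * A $$ (l, i) = (if l = i then ?B $$ (i, i) * A $$ (i, i) else 0)"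
        using that zA[of i l] zB[of l i] by (cases l i rule: linorder_cases) auto
    qed simp
    also have "\<dots> = A $$ (i, i) ^ k * A $$ (i, i)" using Suc.IH that by simp
    finally show ?thesis by (simp add: power_commutes)
  qed
  ultimately show ?case using A by (auto simp: upper_triangular_def)
qed

text \<open>Schur decomposition makes \<open>A\<close> similar to an upper triangular matrix with
  diagonal \<open>es\<close>. Similarity passes to powers, preserves the trace, and the diagonal of
  a triangular power consists of the powers of the diagonal entries.\<close>

lemma mat_trace_pow_eq_sum_list:
  fixes A :: "'a :: conjugatable_ordered_field mat"
  assumes A: "A \<in> carrier_mat n n" and es: "char_poly A = (\<Prod>e\<leftarrow>es. [:- e, 1:])"
  shows "mat_trace (A ^\<^sub>m k) = (\<Sum>e\<leftarrow>es. e ^ k)"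
proof -
  obtain B P Q where "schur_decomposition A es = (B, P, Q)" by (metis prod_cases3)
  from schur_decomposition[OF A es this]
  have sim: "similar_mat_wit A B P Q" and ut: "upper_triangular B" and diag: "diag_mat B = es"
    by auto
  have B: "B \<in> carrier_mat n n" using similar_mat_witD2[OF A sim] by simp
  have "mat_trace (A ^\<^sub>m k) = mat_trace (B ^\<^sub>m k)"
    by (rule mat_trace_similar[OF similar_mat_wit_pow[OF sim]])
  also have "\<dots> = (\<Sum>i<n. B $$ (i, i) ^ k)"
    using upper_triangular_pow[OF B ut, of k] B by (simp add: mat_trace_def)
  also have "\<dots> = (\<Sum>e\<leftarrow>es. e ^ k)"
    unfolding diag[symmetric] using B
    by (simp add: diag_mat_def sum_list_distinct_conv_sum_set o_def atLeast0LessThan)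
  finally show ?thesis .
qed

lemma pow_mat_uminus:
  fixes A :: "'a :: ring_1 mat"
  assumes "A \<in> carrier_mat n n"
  shows "(- A) ^\<^sub>m k = (- 1) ^ k \<cdot>\<^sub>m (A ^\<^sub>m k)"
proof (induction k)
  case 0
  then show ?case using assms by auto
next
  case (Suc k)
  have "(- A) ^\<^sub>m Suc k = ((- 1) ^ k \<cdot>\<^sub>m (A ^\<^sub>m k)) * (- A)" using Suc by simp
  also have "\<dots> = (- 1) ^ Suc k \<cdot>\<^sub>m (A ^\<^sub>m k * A)"
    using assms by (intro eq_matI) (auto simp: scalar_prod_def sum_distrib_left sum_negf mult.assoc)
  finally show ?case by simp
qed

text \<open>Equal characteristic polynomials mean equal eigenvalue lists, so \<open>A\<close> and \<open>- A\<close> have the same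
  power sums of eigenvalues.\<close>

lemma odd_mat_trace_eq_0:
  fixes A :: "int mat"
  assumes A: "A \<in> carrier_mat n n" and eq: "char_poly (- A) = char_poly A" and "odd k"
  shows "mat_trace (A ^\<^sub>m k) = 0"
proof -
  \<comment> \<open>Over the complex numbers the characteristic polynomial splits into linear
    factors, which supplies the list of eigenvalues.\<close>
  let ?h = "of_int :: int \<Rightarrow> complex"
  let ?C = "map_mat ?h A"
  have C: "?C \<in> carrier_mat n n" using A by simp
  obtain es where es: "char_poly ?C = (\<Prod>e\<leftarrow>es. [:- e, 1:])"
    using char_poly_factorized[OF C] by blast
  have "- ?C = map_mat ?h (- A)" using A by (intro eq_matI) auto
  then have "char_poly (- ?C) = char_poly ?C"
    using of_int_hom.char_poly_hom[of A n, where ?'a = complex]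
      of_int_hom.char_poly_hom[of "- A" n, where ?'a = complex] A eq by simp
  then have "mat_trace (?C ^\<^sub>m k) = mat_trace ((- ?C) ^\<^sub>m k)"
    using mat_trace_pow_eq_sum_list[OF C es] mat_trace_pow_eq_sum_list[of "- ?C" n es] C es by simp
  also have "\<dots> = - mat_trace (?C ^\<^sub>m k)"
    unfolding pow_mat_uminus[OF C] using \<open>odd k\<close> C
    by (auto simp: mat_trace_def sum_negf)
  finally have "mat_trace (?C ^\<^sub>m k) = 0" by simp
  moreover have "mat_trace (?C ^\<^sub>m k) = ?h (mat_trace (A ^\<^sub>m k))"
    unfolding of_int_hom.mat_hom_pow[OF A, symmetric] using A by (auto simp: mat_trace_def)
  ultimately show ?thesis by simp
qed

section \<open>Bipartite graphs\<close>

lemma adjacency_matrix_carrier [simp]: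
  "adjacency_matrix G vs \<in> carrier_mat (length vs) (length vs)"
  by (simp add: adjacency_matrix_def)

lemma adjacency_matrix_pow_nonneg:
  assumes "i < length vs" "j < length vs"
  shows "(adjacency_matrix G vs ^\<^sub>m k) $$ (i, j) \<ge> 0"
  using assms
proof (induction k arbitrary: j)
  case 0
  then show ?case by (auto simp: adjacency_matrix_def)
next
  case (Suc k)
  then show ?case
    by (auto simp: adjacency_matrix_def scalar_prod_def intro!: sum_nonneg)
qed

text \<open>Entry \<open>(i, j)\<close> of the \<open>k\<close>-th power counts walks of length
  \<open>k\<close>; positivity is enough here. The summand belonging to the last intermediate vertex
  of the given walk is positive, and the others are nonnegative.\<close>

lemma adjacency_matrix_pow_pos:
  assumes V: "parcs G \<subseteq> set vs \<times> set vs" and "distinct vs"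
    and "i < length vs" "j < length vs" and "(vs ! i, vs ! j) \<in> parcs G ^^ k"
  shows "(adjacency_matrix G vs ^\<^sub>m k) $$ (i, j) > 0"
  using assms(3-)
proof (induction k arbitrary: j)
  case 0
  then show ?case using \<open>distinct vs\<close> by (auto simp: adjacency_matrix_def nth_eq_iff_index_eq)
next
  case (Suc k)
  let ?A = "adjacency_matrix G vs" and ?n = "length vs"
  from Suc.prems obtain w where w: "(vs ! i, w) \<in> parcs G ^^ k" "(w, vs ! j) \<in> parcs G" by auto
  then obtain l where l: "l < ?n" "w = vs ! l" using V by (metis SigmaD1 in_set_conv_nth subsetD)
  have "0 < (?A ^\<^sub>m k) $$ (i, l) * ?A $$ (l, j)"
    using Suc.IH[OF Suc.prems(1) l(1)] w l Suc.prems by (simp add: adjacency_matrix_def)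
  also have "\<dots> \<le> (\<Sum>l<?n. (?A ^\<^sub>m k) $$ (i, l) * ?A $$ (l, j))"
    by (rule member_le_sum)
      (use l Suc.prems adjacency_matrix_pow_nonneg[of i vs _ G k] in
        \<open>auto simp: adjacency_matrix_def\<close>)
  also have "\<dots> = (?A ^\<^sub>m Suc k) $$ (i, j)"
    using Suc.prems by (simp add: adjacency_matrix_def scalar_prod_def atLeast0LessThan)
  finally show ?case .
qed

text \<open>Colour each vertex by the parity of the walks to it from a representative of its component.\<close>

lemma bipartite_if_no_odd_closed_walk:
  assumes V: "parcs G \<subseteq> pverts G \<times> pverts G" and sym: "sym (parcs G)"
    and odd: "\<And>v k. odd k \<Longrightarrow> (v, v) \<notin> parcs G ^^ k"
  shows "bipartite G"
proof -
  let ?E = "parcs G"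
  \<comment> \<open>The choice depends only on the set of vertices that reach \<open>v\<close>, so
    adjacent vertices, which are reached from the same vertices, get the very same
    representative.\<close>
  define r where "r v = (SOME u. (u, v) \<in> ?E\<^sup>*)" for v
  define X where "X = {v \<in> pverts G. \<exists>k. even k \<and> (r v, v) \<in> ?E ^^ k}"
  have symk: "(u, v) \<in> ?E ^^ k" if "(v, u) \<in> ?E ^^ k" for u v k
    using that
  proof (induction k arbitrary: u)
    case (Suc k)
    then obtain w where "(v, w) \<in> ?E ^^ k" "(w, u) \<in> ?E" by auto
    with Suc.IH sym have "(w, v) \<in> ?E ^^ k" "(u, w) \<in> ?E" by (auto dest: symD)
    then show ?case by (rule relpow_Suc_I2[rotated])
  qed simp
  have walk: "\<exists>k. (r v, v) \<in> ?E ^^ k" for v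
    unfolding r_def rtrancl_power[symmetric] by (rule someI[of _ v]) simp
  have r_eq: "r u = r v" if "(u, v) \<in> ?E" for u v
  proof -
    have "(w, u) \<in> ?E\<^sup>* \<longleftrightarrow> (w, v) \<in> ?E\<^sup>*" for w
      using that sym by (meson rtrancl.rtrancl_into_rtrancl symD)
    then show ?thesis by (simp add: r_def)
  qed
  \<comment> \<open>Going from the representative to \<open>u\<close>, along the edge to
    \<open>v\<close> and back gives a closed walk of length \<open>j + 1 + k\<close>, which cannot
    be odd.\<close>
  have parity: "odd (j + k)" if uv: "(u, v) \<in> ?E" and "(r u, u) \<in> ?E ^^ j" "(r v, v) \<in> ?E ^^ k"
    for u v j k
  proof
    assume "even (j + k)"
    have "(r u, v) \<in> ?E ^^ Suc j" using that by auto
    moreover have "(v, r u) \<in> ?E ^^ k" using symk that r_eq[OF uv] by simp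
    ultimately have "(r u, r u) \<in> ?E ^^ (Suc j + k)" by (metis relpow_add relcomp.relcompI)
    then show False using odd[of "Suc j + k"] \<open>even (j + k)\<close> by simp
  qed
  have "u \<in> X \<longleftrightarrow> v \<notin> X" if uv: "(u, v) \<in> ?E" for u v
  proof -
    obtain j k where jk: "(r u, u) \<in> ?E ^^ j" "(r v, v) \<in> ?E ^^ k" using walk by metis
    have "u \<in> pverts G" "v \<in> pverts G" using V uv by auto
    \<comment> \<open>The parity of a walk to \<open>u\<close> does not depend on the walk: any two
      are compared with one fixed walk to the neighbour \<open>v\<close>.\<close>
    moreover have "even j' \<longleftrightarrow> even j" if "(r u, u) \<in> ?E ^^ j'" for j'
      using parity[OF uv jk] parity[OF uv that jk(2)] by simp
    moreover have "even k' \<longleftrightarrow> even k" if "(r v, v) \<in> ?E ^^ k'" for k'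
      using parity[OF uv jk] parity[OF uv jk(1) that] by simp
    ultimately have "u \<in> X \<longleftrightarrow> even j" "v \<in> X \<longleftrightarrow> even k"
      using jk unfolding X_def by blast+
    then show ?thesis using parity[OF uv jk] by auto
  qed
  then have "\<forall>(u, v) \<in> ?E. (u \<in> X \<and> v \<in> pverts G - X) \<or> (u \<in> pverts G - X \<and> v \<in> X)"
    using V by blast
  moreover have "X \<union> (pverts G - X) = pverts G" "X \<inter> (pverts G - X) = {}" by (auto simp: X_def)
  ultimately show ?thesis unfolding bipartite_def by blast
qed

lemma char_poly_uminus_adjacency_matrix:
  assumes "bipartite G" and vs: "set vs = pverts G"
  shows "char_poly (- adjacency_matrix G vs) = char_poly (adjacency_matrix G vs)"
proof -
  obtain X Y where XY: "X \<inter> Y = {}"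
    "\<forall>(u, v) \<in> parcs G. (u \<in> X \<and> v \<in> Y) \<or> (u \<in> Y \<and> v \<in> X)"
    using assms by (auto simp: bipartite_def)
  define n where "n = length vs"
  \<comment> \<open>An edge joins vertices of opposite sign, so \<open>s i * s j = - 1\<close>
    wherever the adjacency matrix has a nonzero entry. The matrix \<open>D\<close> is its own
    inverse.\<close>
  define s :: "nat \<Rightarrow> int" where "s i = (if vs ! i \<in> X then 1 else - 1)" for i
  define D where "D = mat n n (\<lambda>(i, j). if i = j then s i else 0)"
  let ?A = "adjacency_matrix G vs"
  have left: "(D * B) $$ (i, j) = s i * B $$ (i, j)"
    if "B \<in> carrier_mat n n" "i < n" "j < n" for B i j
  proof -
    have "(D * B) $$ (i, j) = (\<Sum>l<n. if i = l then s i * B $$ (l, j) else 0)"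
      using that by (simp add: D_def scalar_prod_def atLeast0LessThan if_distrib if_distribR
          cong: if_cong)
    then show ?thesis using that by simp
  qed
  have right: "(B * D) $$ (i, j) = B $$ (i, j) * s j"
    if "B \<in> carrier_mat n n" "i < n" "j < n" for B i j
  proof -
    have "(B * D) $$ (i, j) = (\<Sum>l<n. if l = j then B $$ (i, l) * s l else 0)"
      using that by (simp add: D_def scalar_prod_def atLeast0LessThan if_distrib if_distribR
          cong: if_cong)
    then show ?thesis using that by simp
  qed
  have carr: "D \<in> carrier_mat n n" "?A \<in> carrier_mat n n" by (simp_all add: D_def n_def)
  have DD: "D * D = 1\<^sub>m n"
  proof (rule eq_matI)
    fix i j assume "i < dim_row (1\<^sub>m n :: int mat)" "j < dim_col (1\<^sub>m n :: int mat)"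
    then show "(D * D) $$ (i, j) = 1\<^sub>m n $$ (i, j)"
      using left[OF carr(1), of i j] by (auto simp: D_def s_def)
  qed (auto simp: D_def)
  have "- ?A = D * ?A * D"
  proof (rule eq_matI)
    fix i j assume "i < dim_row (D * ?A * D)" "j < dim_col (D * ?A * D)"
    then have ij: "i < n" "j < n" using carr by auto
    have "(D * ?A * D) $$ (i, j) = s i * ?A $$ (i, j) * s j"
      using left[OF carr(2) ij] right[of "D * ?A", OF _ ij] carr by simp
    also have "\<dots> = (- ?A) $$ (i, j)"
      using ij XY by (auto simp: adjacency_matrix_def n_def s_def)
    finally show "(- ?A) $$ (i, j) = (D * ?A * D) $$ (i, j)" by simp
  qed (use carr in auto)
  then have "similar_mat (- ?A) ?A"
    unfolding similar_mat_def using similar_mat_witI[of D D n "- ?A" ?A] DD carr by auto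
  then show ?thesis by (rule char_poly_similar)
qed

lemma bipartite_iff_char_poly_uminus:
  assumes "pair_graph G" and vs: "distinct vs" "set vs = pverts G"
  shows "bipartite G \<longleftrightarrow> char_poly (- adjacency_matrix G vs) = char_poly (adjacency_matrix G vs)"
proof
  let ?A = "adjacency_matrix G vs" and ?n = "length vs"
  interpret pair_graph G by fact
  assume eq: "char_poly (- ?A) = char_poly ?A"
  have V: "parcs G \<subseteq> pverts G \<times> pverts G" using in_arcsD1 in_arcsD2 by auto
  show "bipartite G"
  proof (rule bipartite_if_no_odd_closed_walk)
    show "parcs G \<subseteq> pverts G \<times> pverts G" by (fact V)
    show "sym (parcs G)" using pair_sym_arcs by (auto simp: symmetric_def intro!: symI dest: symD)
    fix v and k :: nat
    assume "odd k"
    show "(v, v) \<notin> parcs G ^^ k"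
    proof
      assume v: "(v, v) \<in> parcs G ^^ k"
      \<comment> \<open>A walk of length 0 would not force \<open>v\<close> to be a vertex; an odd
        length is positive.\<close>
      obtain k' where "k = Suc k'" using \<open>odd k\<close> by (cases k) auto
      then have "v \<in> set vs" using v V vs by auto
      then obtain i where i: "i < ?n" "v = vs ! i" by (metis in_set_conv_nth)
      have "(\<Sum>j<?n. (?A ^\<^sub>m k) $$ (j, j)) = 0"
        using odd_mat_trace_eq_0[OF adjacency_matrix_carrier eq \<open>odd k\<close>]
        by (simp add: mat_trace_def adjacency_matrix_def)
      \<comment> \<open>A vanishing sum of nonnegative diagonal entries has only zero terms.\<close>
      then have "(?A ^\<^sub>m k) $$ (i, i) = 0"
        using sum_nonneg_0[of "{..<?n}" "\<lambda>j. (?A ^\<^sub>m k) $$ (j, j)" i] i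
          adjacency_matrix_pow_nonneg[of _ vs _ G k] by auto
      moreover have "(?A ^\<^sub>m k) $$ (i, i) > 0"
        using adjacency_matrix_pow_pos[of G vs i i k] V vs i v by simp
      ultimately show False by simp
    qed
  qed
qed (use char_poly_uminus_adjacency_matrix vs in blast)

section \<open>The characteristic polynomial of a hairing\<close>

text \<open>Pulling the sign out of \<open>n\<close> rows gives det(xI + A) = (-1)^n det((-x)I - A);
  then coefficients are compared.\<close>

lemma coeff_char_poly_uminus:
  fixes A :: "'a :: field_char_0 mat"
  assumes A: "A \<in> carrier_mat n n"
  shows "coeff (char_poly (- A)) k = (- 1) ^ (n + k) * coeff (char_poly A) k"
proof -
  have "poly (char_poly (- A)) x = poly (Polynomial.smult ((- 1) ^ n) (char_poly A \<circ>\<^sub>p [:0, - 1:])) x" for x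
  proof -
    have "- char_matrix (- A) x = (- 1) \<cdot>\<^sub>m (- char_matrix A (- x))"
      using A by (intro eq_matI) (auto simp: char_matrix_def)
    then show ?thesis
      using A by (simp add: char_poly_matrix[of _ n] poly_pcompose)
        (simp add: char_matrix_def)
  qed
  then have "char_poly (- A) = Polynomial.smult ((- 1) ^ n) (char_poly A \<circ>\<^sub>p [:0, - 1:])"
    by (simp add: poly_eq_poly_eq_iff[symmetric] fun_eq_iff)
  then show ?thesis by (simp add: coeff_pcompose_linear power_add)
qed

text \<open>The two lower blocks of xI - M are scalar matrices and commute, so the block determinant
  formula applies without inverting any block and the identity includes x = 0.\<close>

lemma poly_char_poly_hairing:
  fixes A :: "'a :: field mat"
  assumes A: "A \<in> carrier_mat n n"
  shows "poly (char_poly (four_block_mat A (1\<^sub>m n) (1\<^sub>m n) (0\<^sub>m n n))) x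
    = det ((x\<^sup>2 - 1) \<cdot>\<^sub>m 1\<^sub>m n - x \<cdot>\<^sub>m A)"
proof -
  let ?M = "four_block_mat A (1\<^sub>m n) (1\<^sub>m n) (0\<^sub>m n n)"
  let ?I = "1\<^sub>m n :: 'a mat"
  have M: "?M \<in> carrier_mat (n + n) (n + n)" using A by simp
  have "- char_matrix ?M x = four_block_mat (x \<cdot>\<^sub>m ?I - A) (- ?I) (- ?I) (x \<cdot>\<^sub>m ?I)"
    using A by (intro eq_matI) (auto simp: char_matrix_def)
  then have "poly (char_poly ?M) x = det (four_block_mat (x \<cdot>\<^sub>m ?I - A) (- ?I) (- ?I) (x \<cdot>\<^sub>m ?I))"
    using char_poly_matrix[OF M] by simp
  also have "\<dots> = det ((x \<cdot>\<^sub>m ?I - A) * (x \<cdot>\<^sub>m ?I) - (- ?I) * (- ?I))"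
    using A by (intro det_four_block_mat) auto
  also have "(x \<cdot>\<^sub>m ?I - A) * (x \<cdot>\<^sub>m ?I) - (- ?I) * (- ?I) = (x\<^sup>2 - 1) \<cdot>\<^sub>m ?I - x \<cdot>\<^sub>m A"
  proof -
    have "x \<cdot>\<^sub>m ?I - A \<in> carrier_mat n n" using A by (rule minus_carrier_mat)
    then have "(x \<cdot>\<^sub>m ?I - A) * (x \<cdot>\<^sub>m ?I) = x \<cdot>\<^sub>m (x \<cdot>\<^sub>m ?I - A)"
      using mult_smult_distrib[of "x \<cdot>\<^sub>m ?I - A" n n ?I n x]
      by (simp add: right_mult_one_mat)
    moreover have "(- ?I) * (- ?I) = ?I" by simp
    ultimately show ?thesis
      using A by (intro eq_matI) (auto simp: power2_eq_square algebra_simps)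
  qed
  finally show ?thesis .
qed

text \<open>These are the coefficients of the functional equation x^(2n) p(1/x) = (-1)^n p(-x),
  whose left side is the reflected polynomial.\<close>

lemma coeff_char_poly_hairing:
  fixes A :: "'a :: field_char_0 mat"
  assumes A: "A \<in> carrier_mat n n" and "k \<le> 2 * n"
  defines "p \<equiv> char_poly (four_block_mat A (1\<^sub>m n) (1\<^sub>m n) (0\<^sub>m n n))"
  shows "coeff p (2 * n - k) = (- 1) ^ (n + k) * coeff p k"
proof -
  have deg: "degree p = 2 * n"
    using degree_monic_char_poly[of "four_block_mat A (1\<^sub>m n) (1\<^sub>m n) (0\<^sub>m n n)" "n + n"] A
    by (simp add: p_def)
  let ?q = "Polynomial.smult ((- 1) ^ n) (p \<circ>\<^sub>p [:0, - 1:])"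
  have eval: "poly (reflect_poly p) x = poly ?q x" if "x \<noteq> 0" for x
  proof -
    have "(- 1) \<cdot>\<^sub>m (((- x)\<^sup>2 - 1) \<cdot>\<^sub>m 1\<^sub>m n - (- x) \<cdot>\<^sub>m A)
        = x\<^sup>2 \<cdot>\<^sub>m (((inverse x)\<^sup>2 - 1) \<cdot>\<^sub>m 1\<^sub>m n - inverse x \<cdot>\<^sub>m A)"
      using A that by (intro eq_matI) (auto simp: field_simps power2_eq_square)
    from arg_cong[OF this, of det] show ?thesis
      using A that unfolding poly_reflect_poly_nz[OF that] deg
      by (simp add: p_def poly_pcompose poly_char_poly_hairing[OF A] power_mult)
  qed
  \<comment> \<open>The values at 0 are not yet compared. Multiplying both sides by the
    indeterminate makes them agree there as well, and the factor is cancelled afterwards.\<close>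
  have "poly ([:0, 1:] * reflect_poly p) = poly ([:0, 1:] * ?q)"
    by (rule ext) (use eval in auto)
  then have "reflect_poly p = ?q" unfolding poly_eq_poly_eq_iff by simp
  then have "coeff (reflect_poly p) k = coeff ?q k" by simp
  then show ?thesis
    using \<open>k \<le> 2 * n\<close> by (simp add: coeff_reflect_poly deg coeff_pcompose_linear power_add)
qed

lemma adjacency_matrix_hairing:
  assumes vs: "distinct vs" "set vs = pverts G" and n: "length vs = n"
  shows "adjacency_matrix (hairing G) (map (\<lambda>v. (v, 0)) vs @ map (\<lambda>v. (v, 1)) vs)
    = four_block_mat (adjacency_matrix G vs) (1\<^sub>m n) (1\<^sub>m n) (0\<^sub>m n n)"
proof (rule eq_matI)
  let ?M = "four_block_mat (adjacency_matrix G vs) (1\<^sub>m n) (1\<^sub>m n) (0\<^sub>m n n)"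
  fix i j assume "i < dim_row ?M" "j < dim_col ?M"
  then have ij: "i < n + n" "j < n + n" using n by (auto simp: adjacency_matrix_def)
  have mem: "vs ! l \<in> pverts G" if "l < n" for l using vs n that nth_mem by blast
  have inj: "vs ! l = vs ! m \<longleftrightarrow> l = m" if "l < n" "m < n" for l m
    using vs n that by (simp add: nth_eq_iff_index_eq)
  show "adjacency_matrix (hairing G) (map (\<lambda>v. (v, 0)) vs @ map (\<lambda>v. (v, 1)) vs) $$ (i, j)
      = ?M $$ (i, j)"
    using ij n mem[of i] mem[of j] mem[of "i - n"] mem[of "j - n"]
      inj[of i "j - n"] inj[of "i - n" j]
    by (cases "i < n"; cases "j < n") (auto simp: adjacency_matrix_def nth_append hairing_def)
qed (use n in \<open>auto simp: adjacency_matrix_def\<close>)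

theorem theorem1:
  fixes G :: "'a pair_pre_digraph" and n :: nat
  assumes "pair_graph G"
    and "card (pverts G) = n"
  shows "absolutely_palindromic (hairing G) \<and>
    (palindromic (hairing G) \<longleftrightarrow> bipartite (hairing G) \<and> even n) \<and>
    (antipalindromic (hairing G) \<longleftrightarrow> bipartite (hairing G) \<and> odd n)"
proof -
  interpret pair_graph G by fact
  obtain vs where vs: "distinct vs" "set vs = pverts G"
    using finite_distinct_list[OF pair_finite_verts] by blast
  have len: "length vs = n" using vs assms(2) distinct_card by metis
  \<comment> \<open>All original vertices come before all pendant ones, the order that yields the
    block form.\<close>
  define ws where "ws = map (\<lambda>v. (v, 0::nat)) vs @ map (\<lambda>v. (v, 1)) vs"
  let ?A = "adjacency_matrix G vs"
  define H where "H = adjacency_matrix (hairing G) ws"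
  let ?h = "of_int :: int \<Rightarrow> complex"
  have ws: "distinct ws" "set ws = pverts (hairing G)"
    using vs by (auto simp: ws_def distinct_map inj_on_def hairing_def)
  define c where "c = coeff (char_poly H)"
  have carr_H: "H \<in> carrier_mat (2 * n) (2 * n)"
    using len by (simp add: H_def ws_def adjacency_matrix_def mult_2)
  have hom: "coeff (char_poly (map_mat ?h B)) k = ?h (coeff (char_poly B) k)"
    if "B \<in> carrier_mat m m" for B m k
    using of_int_hom.char_poly_hom[OF that, where ?'a = complex] by simp
  have A: "?A \<in> carrier_mat n n" using len by (metis adjacency_matrix_carrier)
  have "map_mat ?h H = four_block_mat (map_mat ?h ?A) (1\<^sub>m n) (1\<^sub>m n) (0\<^sub>m n n)"
    unfolding H_def ws_def adjacency_matrix_hairing[OF vs len] using A by (intro eq_matI) auto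
  then have "?h (c (2 * n - k)) = ?h ((- 1) ^ (n + k) * c k)" if "k \<le> 2 * n" for k
    using coeff_char_poly_hairing[of "map_mat ?h ?A" n k] that A
    by (simp add: c_def flip: hom[OF carr_H])
  then have refl: "c (2 * n - k) = (- 1) ^ (n + k) * c k" if "k \<le> 2 * n" for k
    using that of_int_eq_iff by blast
  have lead: "c (2 * n) = 1" and deg: "degree (char_poly H) = 2 * n"
    using degree_monic_char_poly[OF carr_H] by (simp_all add: c_def)
  have "map_mat ?h (- H) = - map_mat ?h H" by (intro eq_matI) auto
  then have "?h (coeff (char_poly (- H)) k) = ?h ((- 1) ^ k * c k)" for k
    using coeff_char_poly_uminus[of "map_mat ?h H" "2 * n" k] carr_H
    by (simp add: c_def power_add flip: hom[OF carr_H] hom[of "- H" "2 * n"])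
  \<comment> \<open>The order \<open>2 * n\<close> of \<open>H\<close> is even, so only the parity
    of \<open>k\<close> remains in the sign.\<close>
  then have neg: "coeff (char_poly (- H)) k = (- 1) ^ k * c k" for k
    using of_int_eq_iff by blast
  have "bipartite (hairing G) \<longleftrightarrow> (\<forall>k. (- 1) ^ k * c k = c k)"
    unfolding bipartite_iff_char_poly_uminus[OF pair_graph_hairing[OF assms(1)] ws] H_def[symmetric]
    by (simp add: poly_eq_iff neg c_def)
  also have "\<dots> \<longleftrightarrow> (\<forall>k. odd k \<longrightarrow> c k = 0)"
    by (simp add: minus_one_power_iff eq_neg_iff_add_eq_0)
  also have "\<dots> \<longleftrightarrow> (\<forall>k\<le>2 * n. odd k \<longrightarrow> c k = 0)"
    using deg unfolding c_def by (metis coeff_eq_0 linorder_not_le)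
  finally have bip: "bipartite (hairing G) \<longleftrightarrow> (\<forall>k\<le>2 * n. odd k \<longrightarrow> c k = 0)" .
  have coeffs: "graph_coeff (hairing G) k = (- 1) ^ (n + k) * c k"
    "graph_coeff (hairing G) (2 * n - k) = c k" if "k \<le> 2 * n" for k
    using refl[OF that] that assms(2)
    by (simp_all add: graph_coeff_def graph_char_poly_eq[OF ws] card_pverts_hairing c_def H_def)
  \<comment> \<open>The two coefficients differ by the factor \<open>(- 1) ^ (n + k)\<close>: one of
    the two equations is automatic, the other forces both to vanish.\<close>
  have "graph_coeff (hairing G) k = graph_coeff (hairing G) (2 * n - k)
      \<longleftrightarrow> (odd (n + k) \<longrightarrow> c k = 0)"
    and "graph_coeff (hairing G) k = - graph_coeff (hairing G) (2 * n - k)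
      \<longleftrightarrow> (even (n + k) \<longrightarrow> c k = 0)"
    and abs: "\<bar>graph_coeff (hairing G) k\<bar> = \<bar>graph_coeff (hairing G) (2 * n - k)\<bar>"
    if "k \<le> 2 * n" for k
    unfolding coeffs[OF that] by (auto simp: minus_one_power_iff)
  then have pal: "palindromic (hairing G) \<longleftrightarrow> (\<forall>k\<le>2 * n. odd (n + k) \<longrightarrow> c k = 0)"
    and anti: "antipalindromic (hairing G) \<longleftrightarrow> (\<forall>k\<le>2 * n. even (n + k) \<longrightarrow> c k = 0)"
    unfolding palindromic_def antipalindromic_def card_pverts_hairing assms(2) by blast+
  \<comment> \<open>At \<open>k = 2 * n\<close> the coefficient is 1, and \<open>n + k\<close> has
    the parity of \<open>n\<close>, so the wrong parity would make the leading coefficient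
    zero.\<close>
  have "even n" if "palindromic (hairing G)"
    using that[unfolded pal, rule_format, of "2 * n"] lead by auto
  moreover have "odd n" if "antipalindromic (hairing G)"
    using that[unfolded anti, rule_format, of "2 * n"] lead by auto
  moreover have "absolutely_palindromic (hairing G)"
    unfolding absolutely_palindromic_def card_pverts_hairing assms(2)
    using abs by blast
  \<comment> \<open>Once the parity of \<open>n\<close> is known, both conditions on
    \<open>n + k\<close> say that \<open>c\<close> vanishes at odd \<open>k\<close>, which is
    bipartiteness.\<close>
  ultimately show ?thesis
    unfolding bip pal anti by (auto simp: even_add)
qed

end
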